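(* Let $\omega$ be a weight function and let $2\le p\le\infty$. There does not exist a constant $D>0$ such that $$\|Rf\|_{L^\infty(\mathbb{R}^{2N})}\le D\,\|\mathrm{Wig}(f)\|_{L^p(\mathbb{R}^{2N})}\qquad\text{for every } f\in\mathcal{S}_\omega(\mathbb{R}^N).$$
   Context: A weight function is a continuous increasing (i.e. nondecreasing) function $\omega:[0,\infty)\to[0,\infty)$ such that: ($\alpha$) there is $K\ge1$ with $\omega(2t)\le K(1+\omega(t))$ for all $t\ge0$; ($\beta$) $\omega(t)=o(t)$ as $t\to\infty$; ($\gamma$) there are $a\in\mathbb{R}$, $b>0$ with $\omega(t)\ge a+b\log(1+t)$ for all $t\ge0$; ($\delta$) $t\mapsto\omega(e^t)$ is convex. One extends $\omega$ to $\mathbb{R}^M$ by $\omega(z)=\omega(|z|)$. Fourier transform: $\hat f(\xi)=\int_{\mathbb{R}^N}e^{-ix\xi}f(x)\,dx$. $\mathcal{S}_\omega(\mathbb{R}^N)$ is the set of all $f\in L^1(\mathbb{R}^N)$ with $f,\hat f\in C^\infty(\mathbb{R}^N)$ and $\|e^{\lambda\omega}\partial^\alpha f\|_\infty<\infty$, $\|e^{\lambda\omega}\partial^\alpha\hat f\|_\infty<\infty$ for all $\lambda>0$, $\alpha\in\mathbb{N}_0^N$; for $\omega(t)=\log(1+t)$ it coincides with the Schwartz space $\mathcal{S}(\mathbb{R}^N)$. Wigner transform: $\mathrm{Wig}(f)(x,\xi)=\int_{\mathbb{R}^N}e^{-it\xi}f(x+\tfrac t2)\overline{f(x-\tfrac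 t2)}\,dt$. Rihaczek form: $Rf(x,\xi)=e^{-ix\xi}f(x)\overline{\hat f(\xi)}$, $(x,\xi)\in\mathbb{R}^{2N}$. *)

theory Defs
  imports
    "HOL-Analysis.Analysis"
    "HOL-Library.Landau_Symbols"
    "HOL-Probability.Essential_Supremum"
begin

text \<open>Only the restriction of \<open>\<omega>\<close> to \<open>[0, \<infinity>)\<close> is constrained.\<close>
definition weight_function :: "(real \<Rightarrow> real) \<Rightarrow> bool" where
  "weight_function \<omega> \<longleftrightarrow>
     continuous_on {0..} \<omega> \<and> mono_on {0..} \<omega> \<and> (\<forall>t\<ge>0. 0 \<le> \<omega> t) \<and>
     (\<exists>K\<ge>1. \<forall>t\<ge>0. \<omega> (2 * t) \<le> K * (1 + \<omega> t)) \<and>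
     \<omega> \<in> o[at_top](\<lambda>t. t) \<and>
     (\<exists>a b. b > 0 \<and> (\<forall>t\<ge>0. \<omega> t \<ge> a + b * ln (1 + t))) \<and>
     convex_on UNIV (\<lambda>t. \<omega> (exp t))"

text \<open>The \<open>L\<^sup>p\<close> norm on a Euclidean space for an exponent \<open>0 < p \<le> \<infinity>\<close>, with value \<open>\<infinity>\<close> allowed;
  the root is taken by hand because \<open>powr\<close> is not available on \<^typ>\<open>ennreal\<close>.\<close>
definition Lp_norm :: "ennreal \<Rightarrow> ('a::euclidean_space \<Rightarrow> complex) \<Rightarrow> ennreal" where
  "Lp_norm p f =
     (if p = \<infinity> then esssup lborel (\<lambda>x. ennreal (norm (f x)))
      else let r = enn2real p;
               I = (\<integral>\<^sup>+ x. ennreal (norm (f x) powr r) \<partial>lborel)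
           in if I = \<infinity> then \<infinity> else ennreal (enn2real I powr (1 / r)))"

definition partial_deriv :: "'n \<Rightarrow> (real ^ 'n \<Rightarrow> complex) \<Rightarrow> real ^ 'n \<Rightarrow> complex" where
  "partial_deriv i f x = vector_derivative (\<lambda>t. f (x + t *\<^sub>R axis i 1)) (at 0)"

text \<open>\<open>C\<^sup>\<infinity>\<close>: the iterated partial derivatives, in any order, all exist and are continuous.\<close>
definition C_infinity :: "(real ^ 'n \<Rightarrow> complex) \<Rightarrow> bool" where
  "C_infinity f \<longleftrightarrow>
     (\<forall>is. continuous_on UNIV (foldr partial_deriv is f) \<and>
        (\<forall>i x. (\<lambda>t. foldr partial_deriv is f (x + t *\<^sub>R axis i 1)) differentiable (at 0)))"

text \<open>\<open>\<partial>\<^sup>\<alpha>\<close> for a multi-index \<open>\<alpha>\<close>. The coordinates are listed in an arbitrary fixed order,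
  which is immaterial for \<open>C\<^sup>\<infinity>\<close> functions.\<close>
definition coordinate_list :: "'n::finite list" where
  "coordinate_list = (SOME is. distinct is \<and> set is = UNIV)"

definition multi_deriv :: "('n \<Rightarrow> nat) \<Rightarrow> (real ^ 'n \<Rightarrow> complex) \<Rightarrow> real ^ 'n \<Rightarrow> complex" where
  "multi_deriv \<alpha> f = foldr (\<lambda>i. partial_deriv i ^^ \<alpha> i) coordinate_list f"

definition fourier :: "(real ^ 'n \<Rightarrow> complex) \<Rightarrow> real ^ 'n \<Rightarrow> complex" where
  "fourier f \<xi> = (\<integral>x. exp (- (\<i> * complex_of_real (x \<bullet> \<xi>))) * f x \<partial>lborel)"

definition S_space :: "(real \<Rightarrow> real) \<Rightarrow> (real ^ 'n \<Rightarrow> complex) set" where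
  "S_space \<omega> = {f. integrable lborel f \<and> C_infinity f \<and> C_infinity (fourier f) \<and>
     (\<forall>l>0. \<forall>\<alpha>.
        Lp_norm \<infinity> (\<lambda>x. complex_of_real (exp (l * \<omega> (norm x))) * multi_deriv \<alpha> f x) < \<infinity> \<and>
        Lp_norm \<infinity> (\<lambda>\<xi>. complex_of_real (exp (l * \<omega> (norm \<xi>))) * multi_deriv \<alpha> (fourier f) \<xi>) < \<infinity>)}"

definition wigner :: "(real ^ 'n \<Rightarrow> complex) \<Rightarrow> (real ^ 'n) \<times> (real ^ 'n) \<Rightarrow> complex" where
  "wigner f = (\<lambda>(x, \<xi>). \<integral>t. exp (- (\<i> * complex_of_real (t \<bullet> \<xi>))) *
     f (x + t /\<^sub>R 2) * cnj (f (x - t /\<^sub>R 2)) \<partial>lborel)"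

definition rihaczek :: "(real ^ 'n \<Rightarrow> complex) \<Rightarrow> (real ^ 'n) \<times> (real ^ 'n) \<Rightarrow> complex" where
  "rihaczek f = (\<lambda>(x, \<xi>). exp (- (\<i> * complex_of_real (x \<bullet> \<xi>))) * f x * cnj (fourier f \<xi>))"

end

theory Submission
  imports Defs "HOL-Probability.Characteristic_Functions"
begin

text \<open>Put \<open>g\<^sub>s(x) = s\<^sup>N exp(- s\<^sup>4|x|\<^sup>2/2)\<close>, all of the same \<open>L\<^sup>2\<close> norm, and test the inequality on
  \<open>f = g\<^sub>s + g\<^sub>1\<close> as \<open>s\<close> tends to infinity. The peak of \<open>f\<close> comes from \<open>g\<^sub>s\<close> and that of its Fourier
  transform from \<open>g\<^sub>1\<close>, so \<open>|Rf(0,0)|\<close> grows at least like \<open>s\<close>. The Wigner transform of \<open>f\<close> is the sum of the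
  four cross-Wigner transforms of \<open>g\<^sub>s\<close> and \<open>g\<^sub>1\<close>, which are explicit complex Gaussians with
  \<open>L\<^sup>\<infinity>\<close> norm bounded and \<open>L\<^sup>2\<close> norm constant in \<open>s\<close>, hence with bounded \<open>L\<^sup>p\<close> norm for every \<open>p \<ge> 2\<close>.\<close>

section \<open>Gaussian integrals\<close>

text \<open>Lebesgue measure on a Euclidean space is the image of the product of one-dimensional
  Lebesgue measures under summing up coordinates. After this change of variables the claim is
  Fubini's theorem for finite products.\<close>

lemma
  fixes f :: "'a::euclidean_space \<Rightarrow> real \<Rightarrow> complex"
  assumes f: "\<And>b. b \<in> Basis \<Longrightarrow> integrable lborel (f b)"
  shows integrable_lborel_prod: "integrable lborel (\<lambda>x. \<Prod>b\<in>Basis. f b (x \<bullet> b))"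
    and integral_lborel_prod:
      "(\<integral>x. (\<Prod>b\<in>Basis. f b (x \<bullet> b)) \<partial>lborel) = (\<Prod>b\<in>Basis. (\<integral>x. f b x \<partial>lborel))"
proof -
  interpret product_sigma_finite "\<lambda>_::'a. lborel :: real measure" ..
  have fb [measurable]: "\<And>b. b \<in> Basis \<Longrightarrow> f b \<in> borel_measurable borel"
    using f borel_measurable_integrable by force
  have meas: "(\<lambda>x::'a. \<Prod>b\<in>Basis. f b (x \<bullet> b)) \<in> borel_measurable borel"
    by measurable
  have T: "(\<lambda>x. \<Sum>b\<in>Basis. x b *\<^sub>R b) \<in> measurable (\<Pi>\<^sub>M b\<in>(Basis::'a set). (lborel::real measure)) borel"
    by measurable
  have comp: "(\<Prod>b\<in>Basis. f b ((\<Sum>c\<in>Basis. x c *\<^sub>R c) \<bullet> b)) = (\<Prod>b\<in>Basis. f b (x b))" for x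
    by (intro prod.cong) (auto simp: inner_sum_left inner_Basis if_distrib sum.delta cong: if_cong)
  show "integrable lborel (\<lambda>x. \<Prod>b\<in>Basis. f b (x \<bullet> b))"
    by (subst lborel_eq, subst integrable_distr_eq[OF T meas], subst comp)
      (rule product_integrable_prod[OF finite_Basis f])
  show "(\<integral>x. (\<Prod>b\<in>Basis. f b (x \<bullet> b)) \<partial>lborel) = (\<Prod>b\<in>Basis. (\<integral>x. f b x \<partial>lborel))"
    by (subst lborel_eq, subst integral_distr[OF T meas], subst comp)
      (rule product_integral_prod[OF finite_Basis f])
qed

lemma integrable_gaussian_real:
  fixes a :: real assumes "a > 0"
  shows "integrable lborel (\<lambda>x. exp (- (a * x\<^sup>2 / 2)))"
proof -
  have "integrable lborel (normal_density 0 (1 / sqrt a))"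
    using assms by simp
  then have "integrable lborel (\<lambda>x. sqrt (2 * pi * (1 / sqrt a)\<^sup>2) * normal_density 0 (1 / sqrt a) x)"
    by simp
  moreover have "sqrt (2 * pi * (1 / sqrt a)\<^sup>2) * normal_density 0 (1 / sqrt a) x = exp (- (a * x\<^sup>2 / 2))" for x
    using assms by (simp add: normal_density_def power_divide field_simps)
  ultimately show ?thesis by simp
qed

lemma integrable_gaussian_iexp_real:
  fixes a \<xi> :: real assumes "a > 0"
  shows "integrable lborel (\<lambda>x. exp (- (\<i> * complex_of_real (x * \<xi>))) * complex_of_real (exp (- (a * x\<^sup>2 / 2))))"
  by (rule Bochner_Integration.integrable_bound[OF integrable_gaussian_real[OF assms]])
    (auto simp: norm_mult)

text \<open>This is the characteristic function of the standard normal law at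
  \<open>- (\<xi> / sqrt a)\<close>, after the substitution of \<open>sqrt a * x\<close> for the
  variable. The Jacobian \<open>sqrt a\<close> and the normalisation \<open>sqrt (2 * pi)\<close>
  together give the constant \<open>sqrt (2 * pi / a)\<close>.\<close>

lemma fourier_gaussian_real:
  fixes a \<xi> :: real assumes "a > 0"
  shows "(\<integral>x. exp (- (\<i> * complex_of_real (x * \<xi>))) * complex_of_real (exp (- (a * x\<^sup>2 / 2))) \<partial>lborel)
    = complex_of_real (sqrt (2 * pi / a) * exp (- (\<xi>\<^sup>2 / (2 * a))))" (is "?I = _")
proof -
  define t where "t = - (\<xi> / sqrt a)"
  have "complex_of_real (exp (- (t\<^sup>2) / 2)) = char std_normal_distribution t"
    by (simp add: char_std_normal_distribution)
  also have "\<dots> = (\<integral>x. std_normal_density x *\<^sub>R iexp (t * x) \<partial>lborel)"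
    unfolding char_def by (subst integral_density) auto
  also have "\<dots> = sqrt a *\<^sub>R (\<integral>x. std_normal_density (0 + sqrt a * x) *\<^sub>R iexp (t * (0 + sqrt a * x)) \<partial>lborel)"
    using assms by (subst lborel_integral_real_affine[where c = "sqrt a" and t = 0]) auto
  also have "(\<lambda>x. std_normal_density (0 + sqrt a * x) *\<^sub>R iexp (t * (0 + sqrt a * x))) =
    (\<lambda>x. (1 / sqrt (2 * pi)) *\<^sub>R (exp (- (\<i> * complex_of_real (x * \<xi>))) * complex_of_real (exp (- (a * x\<^sup>2 / 2)))))"
    using assms
    by (auto simp: fun_eq_iff normal_density_def t_def scaleR_conv_of_real power_mult_distrib mult_ac)
  also have "sqrt a *\<^sub>R (\<integral>x. \<dots> x \<partial>lborel) = (sqrt a / sqrt (2 * pi)) *\<^sub>R ?I"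
    by simp
  finally have "?I = (sqrt (2 * pi) / sqrt a) *\<^sub>R complex_of_real (exp (- (t\<^sup>2) / 2))"
    using assms by simp
  then show ?thesis
    using assms by (simp add: scaleR_conv_of_real t_def power_divide real_sqrt_divide)
qed

text \<open>The parameter is the inverse variance in each coordinate: products of Gaussians centred
  at the origin add their parameters, and the Fourier transform turns \<open>a\<close> into
  \<open>1 / a\<close>.\<close>

definition gaussian :: "real \<Rightarrow> 'a::euclidean_space \<Rightarrow> real" where
  "gaussian a x = exp (- (a * (x \<bullet> x) / 2))"

lemma gaussian_prod: "gaussian a x = (\<Prod>b\<in>Basis. exp (- (a * (x \<bullet> b)\<^sup>2 / 2)))"
  unfolding gaussian_def
  by (subst euclidean_inner)
    (simp add: exp_sum[symmetric] sum_negf[symmetric] sum_distrib_left sum_divide_distrib power2_eq_square)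

lemma continuous_gaussian [continuous_intros]:
  "continuous_on A g \<Longrightarrow> continuous_on A (\<lambda>x. gaussian a (g x))"
  unfolding gaussian_def by (intro continuous_intros) auto

lemma gaussian_measurable [measurable]: "gaussian a \<in> borel_measurable borel"
  by (intro borel_measurable_continuous_onI continuous_intros)

lemma exp_inner_prod:
  "exp (- (\<i> * complex_of_real (x \<bullet> \<xi>))) =
    (\<Prod>b\<in>Basis. exp (- (\<i> * complex_of_real ((x \<bullet> b) * (\<xi> \<bullet> b)))))"
  by (subst euclidean_inner) (simp add: exp_sum[symmetric] sum_negf sum_distrib_left)

text \<open>Both the exponential and the Gaussian factor over the coordinates, so everything reduces
  to dimension one.\<close>

lemma
  fixes \<xi> :: "'a::euclidean_space" assumes "a > 0"
  shows integrable_gaussian_iexp: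
      "integrable lborel (\<lambda>x. exp (- (\<i> * complex_of_real (x \<bullet> \<xi>))) * complex_of_real (gaussian a x))"
    and integral_gaussian_iexp:
      "(\<integral>x. exp (- (\<i> * complex_of_real (x \<bullet> \<xi>))) * complex_of_real (gaussian a x) \<partial>lborel)
        = complex_of_real (sqrt (2 * pi / a) ^ DIM('a) * gaussian (1 / a) \<xi>)"
proof -
  have eq: "exp (- (\<i> * complex_of_real (x \<bullet> \<xi>))) * complex_of_real (gaussian a x) =
    (\<Prod>b\<in>Basis. exp (- (\<i> * complex_of_real ((x \<bullet> b) * (\<xi> \<bullet> b)))) *
       complex_of_real (exp (- (a * (x \<bullet> b)\<^sup>2 / 2))))" for x :: 'a
    unfolding exp_inner_prod[of x] gaussian_prod of_real_prod prod.distrib[symmetric] ..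
  note i = integrable_gaussian_iexp_real[OF assms]
  show "integrable lborel (\<lambda>x. exp (- (\<i> * complex_of_real (x \<bullet> \<xi>))) * complex_of_real (gaussian a x))"
    unfolding eq by (rule integrable_lborel_prod[OF i])
  show "(\<integral>x. exp (- (\<i> * complex_of_real (x \<bullet> \<xi>))) * complex_of_real (gaussian a x) \<partial>lborel)
        = complex_of_real (sqrt (2 * pi / a) ^ DIM('a) * gaussian (1 / a) \<xi>)"
    unfolding eq by (subst integral_lborel_prod[OF i])
      (simp add: fourier_gaussian_real[OF assms] prod.distrib gaussian_prod mult.commute[of a 2] del: of_real_mult of_real_power
         flip: of_real_prod)
qed

lemma
  assumes "a > 0"
  shows integrable_gaussian: "integrable lborel (gaussian a :: 'a::euclidean_space \<Rightarrow> real)"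
    and integral_gaussian: "(\<integral>x. gaussian a x \<partial>(lborel :: 'a measure)) = sqrt (2 * pi / a) ^ DIM('a)"
proof -
  have i: "integrable lborel (\<lambda>x::'a. complex_of_real (gaussian a x))"
    using integrable_gaussian_iexp[OF assms, of "0::'a"] by simp
  then show "integrable lborel (gaussian a :: 'a \<Rightarrow> real)"
    using complex_of_real_integrable_eq by blast
  have "complex_of_real (\<integral>x. gaussian a x \<partial>(lborel :: 'a measure)) = complex_of_real (sqrt (2 * pi / a) ^ DIM('a))"
    using integral_gaussian_iexp[OF assms, of "0::'a"] by (simp add: gaussian_def)
  then show "(\<integral>x. gaussian a x \<partial>(lborel :: 'a measure)) = sqrt (2 * pi / a) ^ DIM('a)"
    using of_real_eq_iff by blast
qed

lemma nn_integral_gaussian: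
  assumes "a > 0"
  shows "(\<integral>\<^sup>+x. ennreal (gaussian a x) \<partial>(lborel :: 'a::euclidean_space measure)) = ennreal (sqrt (2 * pi / a) ^ DIM('a))"
  by (subst nn_integral_eq_integral[OF integrable_gaussian[OF assms]])
    (auto simp: integral_gaussian[OF assms] gaussian_def)

lemma fourier_gaussian:
  assumes "a > 0"
  shows "fourier (\<lambda>x. complex_of_real (gaussian a x)) = (\<lambda>\<xi>::real^'n. complex_of_real (sqrt (2 * pi / a) ^ CARD('n) * gaussian (1 / a) \<xi>))"
  unfolding fourier_def integral_gaussian_iexp[OF assms] by simp

section \<open>Polynomial multiples of Gaussians\<close>

text \<open>A class that contains the test functions and their Fourier transforms and is stable
  under partial derivatives. The sum rule admits Gaussians of different widths, and induction
  replaces any bookkeeping of the polynomial factors.\<close>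

inductive_set poly_gaussians :: "(real ^ 'n \<Rightarrow> complex) set" where
  gaussian: "a > 0 \<Longrightarrow> (\<lambda>x. complex_of_real (gaussian a x)) \<in> poly_gaussians"
| coord: "f \<in> poly_gaussians \<Longrightarrow> (\<lambda>x. complex_of_real (x $ i) * f x) \<in> poly_gaussians"
| scale: "f \<in> poly_gaussians \<Longrightarrow> (\<lambda>x. c * f x) \<in> poly_gaussians"
| add: "f \<in> poly_gaussians \<Longrightarrow> g \<in> poly_gaussians \<Longrightarrow> (\<lambda>x. f x + g x) \<in> poly_gaussians"

lemma continuous_poly_gaussian: "f \<in> poly_gaussians \<Longrightarrow> continuous_on UNIV f"
  by (induction rule: poly_gaussians.induct) (intro continuous_intros; simp)+

lemma gaussian_has_partial_derivative:
  "((\<lambda>t. gaussian a (x + t *\<^sub>R axis i 1 :: real ^ 'n)) has_real_derivative - a * (x $ i * gaussian a x)) (at 0)"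
proof -
  have eq: "gaussian a (x + t *\<^sub>R axis i 1) = exp (- (a * (x \<bullet> x + 2 * t * (x $ i) + t\<^sup>2) / 2))" for t
    by (simp add: gaussian_def inner_add_left inner_add_right inner_axis inner_commute[of "axis i 1" x]
        power2_eq_square algebra_simps)
  show ?thesis
    unfolding eq by (auto intro!: derivative_eq_intros simp: gaussian_def)
qed

text \<open>Differentiating a Gaussian brings down the factor \<open>- a * x $ i\<close>, and the
  product rule handles the coordinate factors. Producing a witness \<open>g\<close> gives
  differentiability and the value of \<open>partial_deriv\<close> at once.\<close>

lemma poly_gaussian_has_partial_derivative:
  fixes f :: "real ^ 'n \<Rightarrow> complex"
  shows "f \<in> poly_gaussians \<Longrightarrow>
    \<exists>g\<in>poly_gaussians. \<forall>x. ((\<lambda>t. f (x + t *\<^sub>R axis i 1)) has_vector_derivative g x) (at 0)"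
proof (induction rule: poly_gaussians.induct)
  case (gaussian a)
  have "((\<lambda>t. complex_of_real (gaussian a (x + t *\<^sub>R axis i 1))) has_vector_derivative
      complex_of_real (- a) * (complex_of_real (x $ i) * complex_of_real (gaussian a x))) (at 0)" for x :: "real ^ 'n"
    using has_vector_derivative_of_real[OF gaussian_has_partial_derivative[of a x i]] by simp
  moreover have "(\<lambda>x. complex_of_real (- a) * (complex_of_real (x $ i) * complex_of_real (gaussian a x))) \<in> poly_gaussians"
    by (intro poly_gaussians.intros gaussian)
  ultimately show ?case
    by (intro bexI[where x = "\<lambda>x. complex_of_real (- a) * (complex_of_real (x $ i) * complex_of_real (gaussian a x))"] allI)
next
  case (coord f j)
  then obtain g where g: "g \<in> poly_gaussians"
    "\<And>x. ((\<lambda>t. f (x + t *\<^sub>R axis i 1)) has_vector_derivative g x) (at 0)" by blast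
  have "((\<lambda>t. complex_of_real ((x + t *\<^sub>R axis i 1) $ j) * f (x + t *\<^sub>R axis i 1)) has_vector_derivative
      (complex_of_real (x $ j) * g x + (if i = j then 1 else 0) * f x)) (at 0)" for x
  proof -
    have "((\<lambda>t. (x + t *\<^sub>R axis i 1) $ j) has_real_derivative (if i = j then 1 else 0)) (at 0)"
      by (auto simp: axis_def intro!: derivative_eq_intros)
    from has_vector_derivative_mult[OF has_vector_derivative_of_real[OF this] g(2)[of x]]
    show ?thesis by (simp add: if_distrib cong: if_cong)
  qed
  \<comment> \<open>The Kronecker factor is constant in \<open>x\<close>, so the scaling rule covers
    it, the value 0 included.\<close>
  moreover have "(\<lambda>x. complex_of_real (x $ j) * g x + (if i = j then 1 else 0) * f x) \<in> poly_gaussians"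
    by (intro poly_gaussians.intros coord g)
  ultimately show ?case
    by (intro bexI[where x = "\<lambda>x. complex_of_real (x $ j) * g x + (if i = j then 1 else 0) * f x"] allI)
next
  case (scale f c)
  then obtain g where g: "g \<in> poly_gaussians"
    "\<And>x. ((\<lambda>t. f (x + t *\<^sub>R axis i 1)) has_vector_derivative g x) (at 0)" by blast
  have "((\<lambda>t. c * f (x + t *\<^sub>R axis i 1)) has_vector_derivative c * g x) (at 0)" for x
    using has_vector_derivative_mult_right[OF g(2)] .
  then show ?case
    by (intro bexI[where x = "\<lambda>x. c * g x"] allI poly_gaussians.scale g)
next
  case (add f f')
  then obtain g g' where g: "g \<in> poly_gaussians" "g' \<in> poly_gaussians"
    "\<And>x. ((\<lambda>t. f (x + t *\<^sub>R axis i 1)) has_vector_derivative g x) (at 0)"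
    "\<And>x. ((\<lambda>t. f' (x + t *\<^sub>R axis i 1)) has_vector_derivative g' x) (at 0)" by blast
  have "((\<lambda>t. f (x + t *\<^sub>R axis i 1) + f' (x + t *\<^sub>R axis i 1)) has_vector_derivative g x + g' x) (at 0)" for x
    using has_vector_derivative_add[OF g(3,4)] .
  then show ?case
    by (intro bexI[where x = "\<lambda>x. g x + g' x"] allI poly_gaussians.add g)
qed

lemma
  assumes "f \<in> poly_gaussians"
  shows partial_deriv_poly_gaussian: "partial_deriv i f \<in> poly_gaussians"
    and differentiable_poly_gaussian: "(\<lambda>t. f (x + t *\<^sub>R axis i 1)) differentiable (at 0)"
proof -
  obtain g where g: "g \<in> poly_gaussians"
    "\<And>x. ((\<lambda>t. f (x + t *\<^sub>R axis i 1)) has_vector_derivative g x) (at 0)"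
    using poly_gaussian_has_partial_derivative[OF assms] by blast
  then have "partial_deriv i f = g"
    by (auto simp: partial_deriv_def fun_eq_iff intro: vector_derivative_at)
  with g show "partial_deriv i f \<in> poly_gaussians" by simp
  show "(\<lambda>t. f (x + t *\<^sub>R axis i 1)) differentiable (at 0)"
    using g(2) by (rule differentiableI_vector)
qed

lemma C_infinity_poly_gaussian:
  assumes "f \<in> poly_gaussians" shows "C_infinity f"
proof -
  have "foldr partial_deriv is f \<in> poly_gaussians" for "is"
    by (induction "is") (auto simp: assms partial_deriv_poly_gaussian)
  then show ?thesis
    unfolding C_infinity_def
    using continuous_poly_gaussian differentiable_poly_gaussian by blast
qed

lemma multi_deriv_poly_gaussian:
  assumes "f \<in> poly_gaussians" shows "multi_deriv \<alpha> f \<in> poly_gaussians"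
proof -
  have pow: "(partial_deriv i ^^ k) g \<in> poly_gaussians" if "g \<in> poly_gaussians" for i k g
    using that by (induction k) (auto simp: partial_deriv_poly_gaussian)
  have "foldr (\<lambda>i. partial_deriv i ^^ \<alpha> i) xs f \<in> poly_gaussians" for xs
    by (induction xs) (auto simp: assms pow)
  then show ?thesis unfolding multi_deriv_def .
qed

section \<open>Exponential decay and membership in the weighted space\<close>

text \<open>The rate \<open>k\<close> stays arbitrary in the induction, because a coordinate factor
  has to be paid for with a larger rate.\<close>

lemma poly_gaussian_decay:
  fixes f :: "real ^ 'n \<Rightarrow> complex"
  shows "f \<in> poly_gaussians \<Longrightarrow> \<exists>C. \<forall>x. norm (f x) \<le> C * exp (- (k * norm x))"
proof (induction arbitrary: k rule: poly_gaussians.induct)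
  case (gaussian a)
  have "norm (complex_of_real (gaussian a x)) \<le> exp (k\<^sup>2 / (2 * a)) * exp (- (k * norm x))" for x :: "real ^ 'n"
  proof -
    \<comment> \<open>Expanding this square bounds \<open>- a * (x \<bullet> x) / 2\<close> by
      \<open>k\<^sup>2 / (2 * a) - k * norm x\<close>, which is where the constant
      \<open>exp (k\<^sup>2 / (2 * a))\<close> comes from.\<close>
    have "0 \<le> (a * norm x - k)\<^sup>2 / (2 * a)" using gaussian by simp
    also have "\<dots> = k\<^sup>2 / (2 * a) - k * norm x + a * (x \<bullet> x) / 2"
      using gaussian by (simp add: field_simps power2_eq_square flip: power2_norm_eq_inner)
    finally show ?thesis
      by (simp add: gaussian_def flip: exp_add)
  qed
  then show ?case by blast
next
  case (coord f i)
  \<comment> \<open>The extra 1 in the rate leaves a factor \<open>exp (- norm x)\<close>, which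
    absorbs the coordinate.\<close>
  obtain C where C: "\<And>x. norm (f x) \<le> C * exp (- ((k + 1) * norm x))" using coord.IH by blast
  have "norm (complex_of_real (x $ i) * f x) \<le> C * exp (- (k * norm x))" for x
  proof -
    have "\<bar>x $ i\<bar> \<le> exp (norm x)"
      using component_le_norm_cart[of x i] exp_ge_add_one_self[of "norm x"] by linarith
    then have "norm (complex_of_real (x $ i) * f x) \<le> exp (norm x) * (C * exp (- ((k + 1) * norm x)))"
      unfolding norm_mult norm_of_real by (intro mult_mono C) auto
    also have "\<dots> = C * exp (- (k * norm x))"
      by (simp add: algebra_simps flip: exp_add)
    finally show ?thesis .
  qed
  then show ?case by blast
next
  case (scale f c)
  obtain C where C: "\<And>x. norm (f x) \<le> C * exp (- (k * norm x))" using scale.IH by blast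
  then have "norm (c * f x) \<le> (norm c * C) * exp (- (k * norm x))" for x
    by (simp add: norm_mult mult_left_mono mult.assoc)
  then show ?case by blast
next
  case (add f g)
  obtain C C' where "\<And>x. norm (f x) \<le> C * exp (- (k * norm x))" "\<And>x. norm (g x) \<le> C' * exp (- (k * norm x))"
    using add.IH by blast
  then have "norm (f x + g x) \<le> (C + C') * exp (- (k * norm x))" for x
    unfolding distrib_right by (meson norm_triangle_mono)
  then show ?case by blast
qed

text \<open>Condition (beta) gives the bound by \<open>t\<close> for large arguments, and
  monotonicity bounds the remaining interval by a constant. Slope 1 is enough, since polynomial
  multiples of Gaussians decay at every exponential rate.\<close>

lemma weight_function_le_affine:
  assumes "weight_function \<omega>"
  shows "\<exists>M. \<forall>t\<ge>0. \<omega> t \<le> M + t"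
proof -
  have "\<omega> \<in> o[at_top](\<lambda>t. t)" using assms by (simp add: weight_function_def)
  then have "eventually (\<lambda>t. norm (\<omega> t) \<le> 1 * norm t) at_top"
    by (rule landau_o.smallD) simp
  then obtain T where T: "\<And>t. t \<ge> T \<Longrightarrow> \<bar>\<omega> t\<bar> \<le> \<bar>t\<bar>"
    by (auto simp: eventually_at_top_linorder)
  \<comment> \<open>The maximum keeps the threshold in the half-line on which monotonicity and
    nonnegativity are assumed.\<close>
  define S where "S = max T 0"
  have mono: "mono_on {0..} \<omega>" and nonneg: "\<forall>t\<ge>0. 0 \<le> \<omega> t"
    using assms by (auto simp: weight_function_def)
  have "\<omega> t \<le> \<omega> S + t" if "t \<ge> 0" for t
  proof (cases "t \<ge> S")
    case True
    then show ?thesis using T[of t] nonneg[rule_format, of S] that by (auto simp: S_def)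
  next
    case False
    then have "\<omega> t \<le> \<omega> S" using that by (intro mono_onD[OF mono]) (auto simp: S_def)
    then show ?thesis using that by simp
  qed
  then show ?thesis by blast
qed

lemma Lp_norm_infinity_le:
  assumes "continuous_on UNIV F" "\<And>x. norm (F x) \<le> B"
  shows "Lp_norm \<infinity> F \<le> ennreal B"
proof -
  have "F \<in> borel_measurable borel" using assms(1) by (rule borel_measurable_continuous_onI)
  then show ?thesis
    unfolding Lp_norm_def by (simp add: esssup_I assms(2) ennreal_leI)
qed

text \<open>Up to the constant \<open>exp (l * M)\<close> the weight grows at most like
  \<open>exp (l * norm x)\<close>, and the decay of \<open>f\<close> at the rate \<open>l\<close>
  cancels exactly this.\<close>

lemma poly_gaussian_weighted_bound:
  fixes f :: "real ^ 'n \<Rightarrow> complex"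
  assumes w: "weight_function \<omega>" and f: "f \<in> poly_gaussians" and l: "l > 0"
  shows "Lp_norm \<infinity> (\<lambda>x. complex_of_real (exp (l * \<omega> (norm x))) * f x) < \<infinity>"
proof -
  obtain M where M: "\<And>t. t \<ge> 0 \<Longrightarrow> \<omega> t \<le> M + t" using weight_function_le_affine[OF w] by blast
  obtain C where C: "\<And>x. norm (f x) \<le> C * exp (- (l * norm x))" using poly_gaussian_decay[OF f] by blast
  have "continuous_on {0..} \<omega>" using w by (simp add: weight_function_def)
  then have "continuous_on UNIV (\<lambda>x::real^'n. \<omega> (norm x))"
    by (rule continuous_on_compose2) (auto intro!: continuous_intros)
  then have cont: "continuous_on UNIV (\<lambda>x. complex_of_real (exp (l * \<omega> (norm x))) * f x)"
    by (intro continuous_intros continuous_poly_gaussian f)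
  have "norm (complex_of_real (exp (l * \<omega> (norm x))) * f x) \<le> exp (l * M) * C" for x
  proof -
    have "exp (l * \<omega> (norm x)) \<le> exp (l * (M + norm x))" using M[of "norm x"] l by simp
    then have "norm (complex_of_real (exp (l * \<omega> (norm x))) * f x) \<le> exp (l * (M + norm x)) * (C * exp (- (l * norm x)))"
      unfolding norm_mult norm_of_real abs_exp_cancel by (intro mult_mono C) auto
    also have "\<dots> = exp (l * M) * C" by (simp add: distrib_left exp_add exp_minus)
    finally show ?thesis .
  qed
  from Lp_norm_infinity_le[OF cont this] show ?thesis
    by (simp add: le_less_trans ennreal_less_top)
qed

lemma poly_gaussian_in_S_space:
  assumes "weight_function \<omega>" "integrable lborel f" "f \<in> poly_gaussians" "fourier f \<in> poly_gaussians"
  shows "f \<in> S_space \<omega>"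
  unfolding S_space_def
  using assms by (auto intro: C_infinity_poly_gaussian poly_gaussian_weighted_bound[simplified] multi_deriv_poly_gaussian)

section \<open>Cross-Wigner transforms of Gaussians\<close>

lemma
  fixes f :: "'a::euclidean_space \<Rightarrow> complex"
  assumes "integrable lborel f"
  shows integrable_lborel_translate: "integrable lborel (\<lambda>x. f (c + x))"
    and integral_lborel_translate: "(\<integral>x. f (c + x) \<partial>lborel) = (\<integral>x. f x \<partial>lborel)"
proof -
  have f: "f \<in> borel_measurable borel" using borel_measurable_integrable[OF assms] by simp
  have T: "(+) c \<in> borel \<rightarrow>\<^sub>M borel" by measurable
  show "integrable lborel (\<lambda>x. f (c + x))"
    using assms integrable_distr_eq[OF T[folded measurable_lborel2] f] by (simp add: lborel_distr_plus)
  show "(\<integral>x. f (c + x) \<partial>lborel) = (\<integral>x. f x \<partial>lborel)"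
    using integral_distr[OF T[folded measurable_lborel2] f] by (simp add: lborel_distr_plus)
qed

text \<open>Completing the square in \<open>t\<close>. The first factor on the right is free of
  \<open>t\<close>, and the second is a translated Gaussian in \<open>t\<close>, ready for the
  Fourier integral.\<close>

lemma gaussian_product_symmetric:
  assumes "a > 0" "b > 0"
  shows "gaussian a (x + t /\<^sub>R 2) * gaussian b (x - t /\<^sub>R 2) =
    gaussian (4 * a * b / (a + b)) x * gaussian ((a + b) / 4) ((2 * (a - b) / (a + b)) *\<^sub>R x + t)"
proof -
  define u where "u = x \<bullet> x"
  define v where "v = x \<bullet> t"
  define w where "w = t \<bullet> t"
  \<comment> \<open>Writing \<open>b\<close> as \<open>c - a\<close> leaves a single positive
    denominator, so that the identity becomes a polynomial one in \<open>u\<close>, \<open>v\<close>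
    and \<open>w\<close>.\<close>
  define c where "c = a + b"
  have c: "c > 0" and b: "b = c - a" using assms by (auto simp: c_def)
  have 1: "(x + t /\<^sub>R 2) \<bullet> (x + t /\<^sub>R 2) = u + v + w / 4"
    "(x - t /\<^sub>R 2) \<bullet> (x - t /\<^sub>R 2) = u - v + w / 4"
    by (simp_all add: u_def v_def w_def inner_add_left inner_add_right inner_diff_left inner_diff_right
        inner_commute[of t x] field_simps)
  have 2: "(k *\<^sub>R x + t) \<bullet> (k *\<^sub>R x + t) = k\<^sup>2 * u + 2 * k * v + w" for k
    by (simp add: u_def v_def w_def inner_add_left inner_add_right inner_commute[of t x] power2_eq_square algebra_simps)
  have "a * (u + v + w / 4) / 2 + b * (u - v + w / 4) / 2 = 4 * a * b / (a + b) * u / 2 +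
    (a + b) / 4 * ((2 * (a - b) / (a + b))\<^sup>2 * u + 2 * (2 * (a - b) / (a + b)) * v + w) / 2"
    unfolding c_def[symmetric] b using c by (simp add: field_simps power2_eq_square)
  then show ?thesis
    unfolding gaussian_def 1 2 u_def[symmetric] by (simp flip: exp_add)
qed

text \<open>The polarised form of \<open>wigner\<close>, in which the Wigner transform of a sum can
  be expanded.\<close>

definition cross_wigner :: "(real ^ 'n \<Rightarrow> complex) \<Rightarrow> (real ^ 'n \<Rightarrow> complex) \<Rightarrow> (real ^ 'n) \<times> (real ^ 'n) \<Rightarrow> complex" where
  "cross_wigner f g = (\<lambda>(x, \<xi>). \<integral>t. exp (- (\<i> * complex_of_real (t \<bullet> \<xi>))) *
     f (x + t /\<^sub>R 2) * cnj (g (x - t /\<^sub>R 2)) \<partial>lborel)"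

text \<open>After completing the square, the integral is the Fourier transform of a translate of the
  Gaussian with parameter \<open>(a + b) / 4\<close>. The translation by a multiple of
  \<open>x\<close> turns into the unimodular phase.\<close>

lemma
  fixes x \<xi> :: "real ^ 'n"
  assumes ab: "a > 0" "b > 0"
  shows integrable_cross_wigner_gaussian:
    "integrable lborel (\<lambda>t. exp (- (\<i> * complex_of_real (t \<bullet> \<xi>))) *
       complex_of_real (gaussian a (x + t /\<^sub>R 2)) * cnj (complex_of_real (gaussian b (x - t /\<^sub>R 2))))" (is "integrable lborel ?f")
    and cross_wigner_gaussian:
    "cross_wigner (\<lambda>x. complex_of_real (gaussian a x)) (\<lambda>x. complex_of_real (gaussian b x)) (x, \<xi>) =
      exp (\<i> * complex_of_real (2 * (a - b) / (a + b) * (x \<bullet> \<xi>))) *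
      complex_of_real (sqrt (8 * pi / (a + b)) ^ CARD('n) * gaussian (4 * a * b / (a + b)) x * gaussian (4 / (a + b)) \<xi>)"
proof -
  define k where "k = 2 * (a - b) / (a + b)"
  define h where "h u = exp (- (\<i> * complex_of_real (u \<bullet> \<xi>))) * complex_of_real (gaussian ((a + b) / 4) u)" for u
  define C where "C = exp (\<i> * complex_of_real (k * (x \<bullet> \<xi>))) * complex_of_real (gaussian (4 * a * b / (a + b)) x)"
  have h: "integrable lborel h"
    using integrable_gaussian_iexp[of "(a + b) / 4" \<xi>] ab by (simp add: h_def[abs_def])
  have eq: "?f t = C * h (k *\<^sub>R x + t)" for t
  proof -
    have phase: "exp (- (\<i> * complex_of_real (t \<bullet> \<xi>))) =
        exp (\<i> * complex_of_real (k * (x \<bullet> \<xi>))) * exp (- (\<i> * complex_of_real ((k *\<^sub>R x + t) \<bullet> \<xi>)))"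
      by (simp add: inner_add_left algebra_simps flip: exp_add)
    have "?f t = exp (- (\<i> * complex_of_real (t \<bullet> \<xi>))) *
        complex_of_real (gaussian (4 * a * b / (a + b)) x * gaussian ((a + b) / 4) (k *\<^sub>R x + t))"
      unfolding k_def gaussian_product_symmetric[OF ab, symmetric] by simp
    then show ?thesis
      unfolding phase by (simp only: C_def h_def of_real_mult mult_ac)
  qed
  show "integrable lborel ?f"
    unfolding eq by (intro integrable_mult_right integrable_lborel_translate h)
  have "cross_wigner (\<lambda>x. complex_of_real (gaussian a x)) (\<lambda>x. complex_of_real (gaussian b x)) (x, \<xi>) = C * (\<integral>u. h u \<partial>lborel)"
    unfolding cross_wigner_def prod.case eq by (simp add: integral_lborel_translate[OF h])
  also have "(\<integral>u. h u \<partial>lborel) = complex_of_real (sqrt (8 * pi / (a + b)) ^ CARD('n) * gaussian (4 / (a + b)) \<xi>)"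
    unfolding h_def using integral_gaussian_iexp[of "(a + b) / 4" \<xi>] ab by simp
  finally show "cross_wigner (\<lambda>x. complex_of_real (gaussian a x)) (\<lambda>x. complex_of_real (gaussian b x)) (x, \<xi>) =
      exp (\<i> * complex_of_real (2 * (a - b) / (a + b) * (x \<bullet> \<xi>))) *
      complex_of_real (sqrt (8 * pi / (a + b)) ^ CARD('n) * gaussian (4 * a * b / (a + b)) x * gaussian (4 / (a + b)) \<xi>)"
    by (simp add: C_def k_def)
qed

section \<open>Dilated Gaussians of constant energy\<close>

text \<open>The \<open>L\<^sup>2\<close> norm of this dilated Gaussian does not depend on \<open>s\<close>.\<close>
definition scaled_gaussian :: "real \<Rightarrow> real ^ 'n \<Rightarrow> complex" where
  "scaled_gaussian s x = complex_of_real (s ^ CARD('n)) * complex_of_real (gaussian (s ^ 4) x)"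

lemma scaled_gaussian_poly_gaussian: "s > 0 \<Longrightarrow> scaled_gaussian s \<in> poly_gaussians"
  unfolding scaled_gaussian_def[abs_def] by (intro poly_gaussians.intros) simp

lemma integrable_scaled_gaussian: "s > 0 \<Longrightarrow> integrable lborel (scaled_gaussian s)"
  unfolding scaled_gaussian_def[abs_def] by (intro integrable_mult_right integrable_of_real integrable_gaussian) simp

text \<open>The family is stable under the Fourier transform, with \<open>s\<close> replaced by
  \<open>1 / s\<close>: a high peak is sent to a low one.\<close>

lemma fourier_scaled_gaussian:
  assumes "s > 0"
  shows "fourier (scaled_gaussian s) =
    (\<lambda>\<xi>::real^'n. complex_of_real (sqrt (2 * pi) ^ CARD('n)) * scaled_gaussian (1 / s) \<xi>)"
proof
  fix \<xi> :: "real ^ 'n"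
  have "fourier (scaled_gaussian s) \<xi> = complex_of_real (s ^ CARD('n)) * fourier (\<lambda>x. complex_of_real (gaussian (s ^ 4) x)) \<xi>"
    unfolding fourier_def scaled_gaussian_def by (simp add: mult.left_commute[of "exp _"])
  also have "\<dots> = complex_of_real ((s * sqrt (2 * pi / s ^ 4)) ^ CARD('n) * gaussian (1 / s ^ 4) \<xi>)"
    using assms by (simp add: fourier_gaussian power_mult_distrib)
  \<comment> \<open>This is why the exponent in the definition is 4: the root of
    \<open>s ^ 4\<close> is \<open>s\<^sup>2\<close>, and multiplying its inverse by
    \<open>s\<close> leaves \<open>1 / s\<close>.\<close>
  also have "s * sqrt (2 * pi / s ^ 4) = sqrt (2 * pi) * (1 / s)"
  proof -
    have "sqrt (s ^ 4) = s\<^sup>2" using assms by (intro real_sqrt_unique) (auto simp flip: power_mult)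
    then show ?thesis using assms by (simp add: real_sqrt_divide power2_eq_square)
  qed
  finally show "fourier (scaled_gaussian s) \<xi> = complex_of_real (sqrt (2 * pi) ^ CARD('n)) * scaled_gaussian (1 / s) \<xi>"
    by (simp add: scaled_gaussian_def[of "1 / s"] power_mult_distrib power_divide)
qed

lemma
  fixes x \<xi> :: "real ^ 'n"
  assumes st: "s > 0" "t > 0"
  shows integrable_cross_wigner_scaled_gaussian:
    "integrable lborel (\<lambda>y. exp (- (\<i> * complex_of_real (y \<bullet> \<xi>))) *
       scaled_gaussian s (x + y /\<^sub>R 2) * cnj (scaled_gaussian t (x - y /\<^sub>R 2)))" (is "integrable lborel ?f")
    and cross_wigner_scaled_gaussian:
    "cross_wigner (scaled_gaussian s) (scaled_gaussian t) (x, \<xi>) =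
      exp (\<i> * complex_of_real (2 * (s ^ 4 - t ^ 4) / (s ^ 4 + t ^ 4) * (x \<bullet> \<xi>))) *
      complex_of_real ((s * t * sqrt (8 * pi / (s ^ 4 + t ^ 4))) ^ CARD('n) *
        gaussian (4 * s ^ 4 * t ^ 4 / (s ^ 4 + t ^ 4)) x * gaussian (4 / (s ^ 4 + t ^ 4)) \<xi>)"
proof -
  define g where "g y = exp (- (\<i> * complex_of_real (y \<bullet> \<xi>))) *
       complex_of_real (gaussian (s ^ 4) (x + y /\<^sub>R 2)) * cnj (complex_of_real (gaussian (t ^ 4) (x - y /\<^sub>R 2)))" for y
  have eq: "?f y = complex_of_real ((s * t) ^ CARD('n)) * g y" for y
    by (simp add: g_def scaled_gaussian_def power_mult_distrib mult_ac)
  have pos: "s ^ 4 > 0" "t ^ 4 > 0" using st by auto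
  have g: "integrable lborel g"
    unfolding g_def[abs_def] by (rule integrable_cross_wigner_gaussian[OF pos])
  then show "integrable lborel ?f" unfolding eq by simp
  have "cross_wigner (scaled_gaussian s) (scaled_gaussian t) (x, \<xi>) = complex_of_real ((s * t) ^ CARD('n)) * (\<integral>y. g y \<partial>lborel)"
    unfolding cross_wigner_def prod.case eq by simp
  also have "(\<integral>y. g y \<partial>lborel) = cross_wigner (\<lambda>x. complex_of_real (gaussian (s ^ 4) x)) (\<lambda>x. complex_of_real (gaussian (t ^ 4) x)) (x, \<xi>)"
    unfolding cross_wigner_def g_def by simp
  finally show "cross_wigner (scaled_gaussian s) (scaled_gaussian t) (x, \<xi>) =
      exp (\<i> * complex_of_real (2 * (s ^ 4 - t ^ 4) / (s ^ 4 + t ^ 4) * (x \<bullet> \<xi>))) *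
      complex_of_real ((s * t * sqrt (8 * pi / (s ^ 4 + t ^ 4))) ^ CARD('n) *
        gaussian (4 * s ^ 4 * t ^ 4 / (s ^ 4 + t ^ 4)) x * gaussian (4 / (s ^ 4 + t ^ 4)) \<xi>)"
    by (simp add: cross_wigner_gaussian[OF pos] power_mult_distrib mult_ac)
qed

lemma norm_cross_wigner_scaled_gaussian:
  fixes x \<xi> :: "real ^ 'n"
  assumes st: "s > 0" "t > 0"
  shows "norm (cross_wigner (scaled_gaussian s) (scaled_gaussian t) (x, \<xi>)) =
      (s * t * sqrt (8 * pi / (s ^ 4 + t ^ 4))) ^ CARD('n) *
        gaussian (4 * s ^ 4 * t ^ 4 / (s ^ 4 + t ^ 4)) x * gaussian (4 / (s ^ 4 + t ^ 4)) \<xi>"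
  unfolding cross_wigner_scaled_gaussian[OF st] norm_mult norm_exp_i_times norm_of_real
  using st by (simp add: gaussian_def abs_mult power_abs)

text \<open>The Gaussian factors are at most 1, and the prefactor is bounded uniformly in both
  parameters by the inequality of arithmetic and geometric means for \<open>s ^ 4\<close> and
  \<open>t ^ 4\<close>.\<close>

lemma cross_wigner_scaled_gaussian_bound:
  fixes z :: "(real ^ 'n) \<times> (real ^ 'n)"
  assumes st: "s > 0" "t > 0"
  shows "norm (cross_wigner (scaled_gaussian s) (scaled_gaussian t) z) \<le> sqrt (4 * pi) ^ CARD('n)"
proof -
  obtain x \<xi> where z: "z = (x, \<xi>)" by (cases z)
  have gauss_le: "gaussian c y \<le> 1" if "c \<ge> 0" for c and y :: "real ^ 'n"
    using that by (simp add: gaussian_def)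
  have nn: "0 \<le> gaussian c y" for c and y :: "real ^ 'n" by (simp add: gaussian_def)
  have pos: "s ^ 4 > 0" "t ^ 4 > 0" using st by auto
  have "s * t * sqrt (8 * pi / (s ^ 4 + t ^ 4)) = sqrt ((s * t)\<^sup>2 * (8 * pi / (s ^ 4 + t ^ 4)))"
    using st by (simp only: real_sqrt_mult real_sqrt_abs) simp
  also have "\<dots> \<le> sqrt (4 * pi)"
  proof -
    have "0 \<le> (s\<^sup>2 - t\<^sup>2)\<^sup>2" by simp
    then have "2 * (s * t)\<^sup>2 \<le> s ^ 4 + t ^ 4"
      by (simp add: power2_diff power_mult_distrib flip: power_mult)
    then have "2 * (s * t)\<^sup>2 / (s ^ 4 + t ^ 4) \<le> 1"
      using pos by (intro divide_le_eq_1_pos[THEN iffD2]) linarith+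
    then have "4 * pi * (2 * (s * t)\<^sup>2 / (s ^ 4 + t ^ 4)) \<le> 4 * pi * 1" by (intro mult_left_mono) auto
    then show ?thesis by (simp add: mult_ac)
  qed
  finally have "(s * t * sqrt (8 * pi / (s ^ 4 + t ^ 4))) ^ CARD('n) \<le> sqrt (4 * pi) ^ CARD('n)"
    using st by (intro power_mono) auto
  then have "(s * t * sqrt (8 * pi / (s ^ 4 + t ^ 4))) ^ CARD('n) *
        gaussian (4 * s ^ 4 * t ^ 4 / (s ^ 4 + t ^ 4)) x * gaussian (4 / (s ^ 4 + t ^ 4)) \<xi>
    \<le> sqrt (4 * pi) ^ CARD('n) * 1 * 1"
    using st by (intro mult_mono gauss_le nn) (auto intro!: mult_nonneg_nonneg nn)
  then show ?thesis unfolding z norm_cross_wigner_scaled_gaussian[OF st] by simp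
qed

lemma nn_integral_gaussian_prod:
  assumes "a > 0" "b > 0"
  shows "(\<integral>\<^sup>+z. ennreal (gaussian a (fst z) * gaussian b (snd z)) \<partial>(lborel :: ('a::euclidean_space \<times> 'b::euclidean_space) measure))
    = ennreal (sqrt (2 * pi / a) ^ DIM('a) * sqrt (2 * pi / b) ^ DIM('b))"
proof -
  have nn: "0 \<le> gaussian c y" for c and y :: "'c::euclidean_space" by (simp add: gaussian_def)
  have "(\<integral>\<^sup>+z. ennreal (gaussian a (fst z) * gaussian b (snd z)) \<partial>(lborel :: ('a \<times> 'b) measure))
      = (\<integral>\<^sup>+x. \<integral>\<^sup>+y. ennreal (gaussian a (x::'a)) * ennreal (gaussian b (y::'b)) \<partial>lborel \<partial>lborel)"
    unfolding lborel_prod[symmetric]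
    by (subst lborel.nn_integral_fst[symmetric]) (auto simp: ennreal_mult nn)
  also have "\<dots> = ennreal (sqrt (2 * pi / a) ^ DIM('a)) * ennreal (sqrt (2 * pi / b) ^ DIM('b))"
    by (simp add: nn_integral_cmult nn_integral_multc nn_integral_gaussian assms)
  finally show ?thesis using assms by (simp add: ennreal_mult)
qed

text \<open>An instance of Moyal's identity, by which the integral is
  \<open>(2 * pi) ^ CARD('n)\<close> times the product of the squared L^2 norms; each of these is
  \<open>sqrt pi ^ CARD('n)\<close>. Here it is computed directly from the closed form.\<close>

lemma nn_integral_cross_wigner_scaled_gaussian:
  assumes st: "s > 0" "t > 0"
  shows "(\<integral>\<^sup>+z. ennreal ((norm (cross_wigner (scaled_gaussian s) (scaled_gaussian t) z))\<^sup>2)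
      \<partial>(lborel :: ((real ^ 'n) \<times> (real ^ 'n)) measure)) = ennreal ((2 * pi\<^sup>2) ^ CARD('n))"
proof -
  define c where "c = s ^ 4 + t ^ 4"
  have c: "c > 0" using st by (simp add: c_def add_pos_pos)
  define A where "A = ((s * t)\<^sup>2 * (8 * pi / c)) ^ CARD('n)"
  have A: "A \<ge> 0" using c by (simp add: A_def)
  have sq: "(gaussian k y)\<^sup>2 = gaussian (2 * k) y" for k and y :: "real ^ 'n"
    by (simp add: gaussian_def power2_eq_square flip: exp_add)
  have "(norm (cross_wigner (scaled_gaussian s) (scaled_gaussian t) z))\<^sup>2 =
      A * (gaussian (2 * (4 * s ^ 4 * t ^ 4 / c)) (fst z) * gaussian (2 * (4 / c)) (snd z))" for z :: "(real ^ 'n) \<times> (real ^ 'n)"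
  proof -
    define K where "K = (s * t * sqrt (8 * pi / c)) ^ CARD('n)"
    have "K\<^sup>2 = ((s * t * sqrt (8 * pi / c))\<^sup>2) ^ CARD('n)"
      by (simp only: K_def power_mult[symmetric] mult.commute)
    also have "(s * t * sqrt (8 * pi / c))\<^sup>2 = (s * t)\<^sup>2 * (8 * pi / c)"
      using c by (simp add: power_mult_distrib)
    finally have "K\<^sup>2 = A" by (simp add: A_def)
    moreover have "norm (cross_wigner (scaled_gaussian s) (scaled_gaussian t) z) =
        K * gaussian (4 * s ^ 4 * t ^ 4 / c) (fst z) * gaussian (4 / c) (snd z)"
      using norm_cross_wigner_scaled_gaussian[OF st, of "fst z" "snd z"] by (simp add: K_def c_def)
    ultimately show ?thesis
      by (simp add: power_mult_distrib sq)
  qed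
  then have "(\<integral>\<^sup>+z. ennreal ((norm (cross_wigner (scaled_gaussian s) (scaled_gaussian t) z))\<^sup>2)
      \<partial>(lborel :: ((real ^ 'n) \<times> (real ^ 'n)) measure)) =
    (\<integral>\<^sup>+z. ennreal A * ennreal (gaussian (2 * (4 * s ^ 4 * t ^ 4 / c)) (fst z) * gaussian (2 * (4 / c)) (snd z))
      \<partial>(lborel :: ((real ^ 'n) \<times> (real ^ 'n)) measure))"
    using A by (simp add: ennreal_mult gaussian_def)
  also have "\<dots> = ennreal A * ennreal (sqrt (2 * pi / (2 * (4 * s ^ 4 * t ^ 4 / c))) ^ CARD('n) * sqrt (2 * pi / (2 * (4 / c))) ^ CARD('n))"
  proof (subst nn_integral_cmult)
    show "ennreal A * (\<integral>\<^sup>+z. ennreal (gaussian (2 * (4 * s ^ 4 * t ^ 4 / c)) (fst z) * gaussian (2 * (4 / c)) (snd z))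
      \<partial>(lborel :: ((real ^ 'n) \<times> (real ^ 'n)) measure)) = ennreal A * ennreal (sqrt (2 * pi / (2 * (4 * s ^ 4 * t ^ 4 / c))) ^ CARD('n) * sqrt (2 * pi / (2 * (4 / c))) ^ CARD('n))"
      using c st by (subst nn_integral_gaussian_prod) auto
  qed (simp add: borel_prod[symmetric])
  \<comment> \<open>All factors are powers with exponent \<open>CARD('n)\<close>, so the
    cancellation of \<open>s\<close>, \<open>t\<close> and \<open>c\<close> is checked for the base
    alone.\<close>
  also have "\<dots> = ennreal (((s * t)\<^sup>2 * (8 * pi / c) * (sqrt (2 * pi / (2 * (4 * s ^ 4 * t ^ 4 / c))) * sqrt (2 * pi / (2 * (4 / c))))) ^ CARD('n))"
    by (subst ennreal_mult'[OF A, symmetric]) (simp only: A_def power_mult_distrib mult.assoc)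
  also have "sqrt (2 * pi / (2 * (4 * s ^ 4 * t ^ 4 / c))) * sqrt (2 * pi / (2 * (4 / c))) = pi * c / (4 * (s * t)\<^sup>2)"
    unfolding real_sqrt_mult[symmetric] using c st
    by (intro real_sqrt_unique) (auto simp: field_simps power2_eq_square eval_nat_numeral)
  also have "(s * t)\<^sup>2 * (8 * pi / c) * (pi * c / (4 * (s * t)\<^sup>2)) = 2 * pi\<^sup>2"
    using c st by (simp add: field_simps power2_eq_square)
  finally show ?thesis .
qed

section \<open>Sums of two dilated Gaussians\<close>

text \<open>Interpolation between L^2 and L^infinity: for finite \<open>p\<close> the power
  \<open>r\<close> splits into \<open>r - 2\<close>, estimated by \<open>B\<close>, and 2, estimated
  by \<open>K\<close>. The constant is quantified before \<open>F\<close>, so that it is uniform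
  over a whole family of functions.\<close>

lemma Lp_norm_bound_exists:
  fixes p :: ennreal and B K :: real
  assumes p: "2 \<le> p" and B: "0 \<le> B" and K: "0 \<le> K"
  shows "\<exists>C\<ge>0. \<forall>F :: 'a::euclidean_space \<Rightarrow> complex.
    continuous_on UNIV F \<longrightarrow> (\<forall>z. norm (F z) \<le> B) \<longrightarrow>
    (\<integral>\<^sup>+z. ennreal ((norm (F z))\<^sup>2) \<partial>lborel) \<le> ennreal K \<longrightarrow> Lp_norm p F \<le> ennreal C"
proof (cases "p = \<infinity>")
  case True
  then show ?thesis using B Lp_norm_infinity_le by blast
next
  case False
  define r where "r = enn2real p"
  have r: "r \<ge> 2"
    using enn2real_mono[OF p] False by (simp add: r_def less_top)
  define L where "L = B powr (r - 2) * K"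
  have "Lp_norm p F \<le> ennreal (L powr (1 / r))"
    if F: "continuous_on UNIV F" "\<And>z. norm (F z) \<le> B"
      "(\<integral>\<^sup>+z. ennreal ((norm (F z))\<^sup>2) \<partial>lborel) \<le> ennreal K" for F :: "'a \<Rightarrow> complex"
  proof -
    have [measurable]: "F \<in> borel_measurable borel" using F(1) by (rule borel_measurable_continuous_onI)
    have le: "norm (F z) powr r \<le> B powr (r - 2) * (norm (F z))\<^sup>2" for z
    proof (cases "F z = 0")
      case False
      then have "norm (F z) powr r = norm (F z) powr (r - 2) * norm (F z) powr 2"
        by (simp del: powr_numeral flip: powr_add)
      also have "\<dots> \<le> B powr (r - 2) * norm (F z) powr 2"
        using r F(2) by (intro mult_right_mono powr_mono2) auto
      finally show ?thesis using False by simp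
    qed simp
    define I where "I = (\<integral>\<^sup>+z. ennreal (norm (F z) powr r) \<partial>lborel)"
    have "I \<le> (\<integral>\<^sup>+z. ennreal (B powr (r - 2)) * ennreal ((norm (F z))\<^sup>2) \<partial>lborel)"
      unfolding I_def by (intro nn_integral_mono) (simp add: le ennreal_leI flip: ennreal_mult)
    also have "\<dots> = ennreal (B powr (r - 2)) * (\<integral>\<^sup>+z. ennreal ((norm (F z))\<^sup>2) \<partial>lborel)"
      by (rule nn_integral_cmult) measurable
    also have "\<dots> \<le> ennreal L"
      using F(3) K by (simp add: L_def ennreal_mult mult_left_mono)
    finally have I: "I \<le> ennreal L" .
    \<comment> \<open>Finiteness selects the branch of \<open>Lp_norm\<close> in which the root is
      taken and makes \<open>enn2real I\<close> the true value of the integral.\<close>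
    then have "I \<noteq> \<infinity>" using ennreal_less_top[of L] by (auto simp: top_unique)
    moreover have "enn2real I \<le> L"
      using I K by (intro enn2real_leI) (auto simp: L_def)
    ultimately show ?thesis
      using False r unfolding Lp_norm_def Let_def r_def[symmetric] I_def[symmetric]
      by (auto intro!: ennreal_leI powr_mono2)
  qed
  then show ?thesis by (intro exI[of _ "L powr (1 / r)"]) auto
qed

text \<open>If the value at \<open>z\<close> exceeded the essential supremum, then by continuity so
  would the values on a ball around \<open>z\<close>, which has positive measure.\<close>

lemma norm_le_Lp_norm_infinity:
  fixes F :: "'a::euclidean_space \<Rightarrow> complex"
  assumes F: "continuous_on UNIV F"
  shows "ennreal (norm (F z)) \<le> Lp_norm \<infinity> F"
proof (rule ccontr)
  define m where "m = Lp_norm \<infinity> F"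
  assume "\<not> ?thesis"
  then have less: "m < ennreal (norm (F z))" by (simp add: m_def)
  define U where "U = {x. m < ennreal (norm (F x))}"
  have "open U"
    unfolding U_def using F by (intro open_Collect_less continuous_intros continuous_on_ennreal) auto
  moreover have "z \<in> U" using less by (simp add: U_def)
  ultimately obtain e where e: "e > 0" "ball z e \<subseteq> U" by (meson open_contains_ball)
  have "emeasure lborel U = 0"
    using esssup_zero_measure[of lborel "\<lambda>x. ennreal (norm (F x))"] by (simp add: U_def m_def Lp_norm_def)
  then have "emeasure lborel (ball z e) = 0"
    using emeasure_mono[OF e(2), of lborel] \<open>open U\<close> by simp
  then show False using content_ball_pos[OF e(1), of z] by (simp add: measure_def)
qed

lemma continuous_cross_wigner_scaled_gaussian:
  assumes "s > 0" "t > 0"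
  shows "continuous_on UNIV (cross_wigner (scaled_gaussian s) (scaled_gaussian t) :: (real ^ 'n) \<times> (real ^ 'n) \<Rightarrow> complex)"
proof -
  have "cross_wigner (scaled_gaussian s) (scaled_gaussian t) = (\<lambda>z.
      exp (\<i> * complex_of_real (2 * (s ^ 4 - t ^ 4) / (s ^ 4 + t ^ 4) * (fst z \<bullet> snd z))) *
      complex_of_real ((s * t * sqrt (8 * pi / (s ^ 4 + t ^ 4))) ^ CARD('n) *
        gaussian (4 * s ^ 4 * t ^ 4 / (s ^ 4 + t ^ 4)) (fst z) * gaussian (4 / (s ^ 4 + t ^ 4)) (snd z :: real ^ 'n)))"
    using cross_wigner_scaled_gaussian[OF assms] by (auto simp: fun_eq_iff)
  then show ?thesis
    by (simp only:) (intro continuous_intros)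
qed

section \<open>The test functions\<close>

definition two_scale_gaussian :: "real \<Rightarrow> real ^ 'n \<Rightarrow> complex" where
  "two_scale_gaussian s x = scaled_gaussian s x + scaled_gaussian 1 x"

text \<open>Sesquilinear expansion. Splitting the integral requires each of the four integrands to
  be integrable.\<close>

lemma wigner_two_scale_gaussian:
  assumes s: "s > 0"
  shows "wigner (two_scale_gaussian s) z =
    cross_wigner (scaled_gaussian s) (scaled_gaussian s) z + cross_wigner (scaled_gaussian s) (scaled_gaussian 1) z +
    (cross_wigner (scaled_gaussian 1) (scaled_gaussian s) z + cross_wigner (scaled_gaussian 1) (scaled_gaussian 1) z)"
proof -
  obtain x \<xi> where z: "z = (x, \<xi>)" by (cases z)
  have eq: "exp (- (\<i> * complex_of_real (t \<bullet> \<xi>))) * two_scale_gaussian s (x + t /\<^sub>R 2) * cnj (two_scale_gaussian s (x - t /\<^sub>R 2)) =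
    exp (- (\<i> * complex_of_real (t \<bullet> \<xi>))) * scaled_gaussian s (x + t /\<^sub>R 2) * cnj (scaled_gaussian s (x - t /\<^sub>R 2)) +
    exp (- (\<i> * complex_of_real (t \<bullet> \<xi>))) * scaled_gaussian s (x + t /\<^sub>R 2) * cnj (scaled_gaussian 1 (x - t /\<^sub>R 2)) +
    (exp (- (\<i> * complex_of_real (t \<bullet> \<xi>))) * scaled_gaussian 1 (x + t /\<^sub>R 2) * cnj (scaled_gaussian s (x - t /\<^sub>R 2)) +
    exp (- (\<i> * complex_of_real (t \<bullet> \<xi>))) * scaled_gaussian 1 (x + t /\<^sub>R 2) * cnj (scaled_gaussian 1 (x - t /\<^sub>R 2)))" for t
    by (simp only: two_scale_gaussian_def complex_cnj_add distrib_left distrib_right add_ac)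
  note i = integrable_cross_wigner_scaled_gaussian
  show ?thesis
    unfolding z wigner_def cross_wigner_def prod.case eq
    by (simp only: Bochner_Integration.integral_add Bochner_Integration.integrable_add i s zero_less_one)
qed

lemma continuous_wigner_two_scale_gaussian:
  assumes "s > 0"
  shows "continuous_on UNIV (wigner (two_scale_gaussian s))"
  unfolding wigner_two_scale_gaussian[OF assms, abs_def]
  by (intro continuous_intros continuous_cross_wigner_scaled_gaussian assms zero_less_one)

lemma wigner_two_scale_gaussian_bound:
  fixes z :: "(real ^ 'n) \<times> (real ^ 'n)"
  assumes s: "s > 0"
  shows "norm (wigner (two_scale_gaussian s) z) \<le> 4 * sqrt (4 * pi) ^ CARD('n)"
proof -
  note b = cross_wigner_scaled_gaussian_bound[of _ _ z]
  have "norm (wigner (two_scale_gaussian s) z) \<le>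
    (sqrt (4 * pi) ^ CARD('n) + sqrt (4 * pi) ^ CARD('n)) + (sqrt (4 * pi) ^ CARD('n) + sqrt (4 * pi) ^ CARD('n))"
    unfolding wigner_two_scale_gaussian[OF s]
    by (intro norm_triangle_mono b s zero_less_one)
  then show ?thesis by simp
qed

text \<open>The elementary bound for the square of a sum of two reals, applied twice; the bracketing
  matches the expansion of the Wigner transform.\<close>

lemma norm_sum4_squared_le:
  fixes a b c d :: "'a::real_normed_vector"
  shows "(norm (a + b + (c + d)))\<^sup>2 \<le> 4 * ((norm a)\<^sup>2 + (norm b)\<^sup>2 + ((norm c)\<^sup>2 + (norm d)\<^sup>2))"
proof -
  have sq: "(x + y)\<^sup>2 \<le> 2 * (x\<^sup>2 + y\<^sup>2)" for x y :: real
    using zero_le_power2[of "x - y"] by (simp add: power2_sum power2_diff)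
  have "(norm (a + b + (c + d)))\<^sup>2 \<le> ((norm a + norm b) + (norm c + norm d))\<^sup>2"
    by (intro power_mono norm_triangle_mono norm_triangle_ineq) auto
  also have "\<dots> \<le> 2 * ((norm a + norm b)\<^sup>2 + (norm c + norm d)\<^sup>2)" by (rule sq)
  also have "\<dots> \<le> 2 * (2 * ((norm a)\<^sup>2 + (norm b)\<^sup>2) + 2 * ((norm c)\<^sup>2 + (norm d)\<^sup>2))"
    by (intro mult_left_mono add_mono sq) auto
  finally show ?thesis by simp
qed

text \<open>The constant 16 is the factor 4 from squaring a sum of four terms, times four cross
  terms with the same integral.\<close>

lemma nn_integral_wigner_two_scale_gaussian:
  assumes s: "s > 0"
  shows "(\<integral>\<^sup>+z. ennreal ((norm (wigner (two_scale_gaussian s) z))\<^sup>2)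
      \<partial>(lborel :: ((real ^ 'n) \<times> (real ^ 'n)) measure)) \<le> ennreal (16 * (2 * pi\<^sup>2) ^ CARD('n))"
proof -
  define W :: "real \<Rightarrow> real \<Rightarrow> (real ^ 'n) \<times> (real ^ 'n) \<Rightarrow> ennreal"
    where "W a b z = ennreal ((norm (cross_wigner (scaled_gaussian a) (scaled_gaussian b) z))\<^sup>2)" for a b z
  have W: "W a b \<in> borel_measurable borel" if "a > 0" "b > 0" for a b
    unfolding W_def[abs_def] using borel_measurable_continuous_onI[OF continuous_cross_wigner_scaled_gaussian[OF that]]
    by measurable
  have int: "(\<integral>\<^sup>+z. W a b z \<partial>lborel) = ennreal ((2 * pi\<^sup>2) ^ CARD('n))" if "a > 0" "b > 0" for a b
    unfolding W_def by (rule nn_integral_cross_wigner_scaled_gaussian[OF that])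
  have [measurable]: "W s s \<in> borel_measurable borel" "W s 1 \<in> borel_measurable borel"
    "W 1 s \<in> borel_measurable borel" "W 1 1 \<in> borel_measurable borel"
    using s by (auto intro: W)
  have "ennreal ((norm (wigner (two_scale_gaussian s) z))\<^sup>2) \<le> 4 * (W s s z + W s 1 z + (W 1 s z + W 1 1 z))" for z
    using ennreal_leI[OF norm_sum4_squared_le, folded wigner_two_scale_gaussian[OF s, of z]]
    by (simp add: W_def wigner_two_scale_gaussian[OF s] ennreal_mult)
  then have "(\<integral>\<^sup>+z. ennreal ((norm (wigner (two_scale_gaussian s) z))\<^sup>2) \<partial>(lborel :: ((real ^ 'n) \<times> (real ^ 'n)) measure)) \<le>
      (\<integral>\<^sup>+z. 4 * (W s s z + W s 1 z + (W 1 s z + W 1 1 z)) \<partial>lborel)"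
    by (rule nn_integral_mono)
  also have "\<dots> = 4 * (ennreal ((2 * pi\<^sup>2) ^ CARD('n)) + ennreal ((2 * pi\<^sup>2) ^ CARD('n)) +
      (ennreal ((2 * pi\<^sup>2) ^ CARD('n)) + ennreal ((2 * pi\<^sup>2) ^ CARD('n))))"
    using s by (simp add: nn_integral_cmult nn_integral_add int)
  also have "\<dots> = ennreal (4 * ((2 * pi\<^sup>2) ^ CARD('n) + (2 * pi\<^sup>2) ^ CARD('n) + ((2 * pi\<^sup>2) ^ CARD('n) + (2 * pi\<^sup>2) ^ CARD('n))))"
    by (simp only: ennreal_mult ennreal_plus ennreal_numeral zero_le_power zero_le_power2 mult_nonneg_nonneg
        zero_le_numeral add_nonneg_nonneg)
  finally show ?thesis by simp
qed

text \<open>Up to the common factor, the transform fixes \<open>scaled_gaussian 1\<close> and sends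
  \<open>s\<close> to \<open>1 / s\<close> in the other summand, so the result is again a two-scale
  Gaussian.\<close>

lemma fourier_two_scale_gaussian:
  assumes s: "s > 0"
  shows "fourier (two_scale_gaussian s) =
    (\<lambda>\<xi>::real^'n. complex_of_real (sqrt (2 * pi) ^ CARD('n)) * two_scale_gaussian (1 / s) \<xi>)"
proof
  fix \<xi> :: "real ^ 'n"
  have [measurable]: "scaled_gaussian a \<in> borel_measurable (borel :: (real ^ 'n) measure)" if "a > 0" for a
    by (intro borel_measurable_continuous_onI continuous_poly_gaussian scaled_gaussian_poly_gaussian that)
  have i: "integrable lborel (\<lambda>x. exp (- (\<i> * complex_of_real (x \<bullet> \<xi>))) * scaled_gaussian a x)" if "a > 0" for a
    by (rule Bochner_Integration.integrable_bound[OF integrable_scaled_gaussian[OF that]])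
      (use that in \<open>auto simp: norm_mult intro!: borel_measurable_times borel_measurable_continuous_onI[of "\<lambda>x. exp _"] continuous_intros\<close>)
  have "fourier (two_scale_gaussian s) \<xi> = fourier (scaled_gaussian s) \<xi> + fourier (scaled_gaussian 1) \<xi>"
    unfolding fourier_def two_scale_gaussian_def distrib_left
    by (rule Bochner_Integration.integral_add[OF i[OF s] i[OF zero_less_one]])
  then show "fourier (two_scale_gaussian s) \<xi> = complex_of_real (sqrt (2 * pi) ^ CARD('n)) * two_scale_gaussian (1 / s) \<xi>"
    by (simp add: fourier_scaled_gaussian s two_scale_gaussian_def distrib_left)
qed

lemma two_scale_gaussian_poly_gaussian: "s > 0 \<Longrightarrow> two_scale_gaussian s \<in> poly_gaussians"
  unfolding two_scale_gaussian_def[abs_def]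
  by (intro poly_gaussians.add scaled_gaussian_poly_gaussian) auto

lemma two_scale_gaussian_in_S_space:
  assumes "weight_function \<omega>" and s: "s > 0"
  shows "two_scale_gaussian s \<in> S_space \<omega>"
proof (rule poly_gaussian_in_S_space[OF assms(1)])
  show "integrable lborel (two_scale_gaussian s)"
    unfolding two_scale_gaussian_def[abs_def]
    using s by (intro Bochner_Integration.integrable_add integrable_scaled_gaussian) auto
  show "fourier (two_scale_gaussian s) \<in> poly_gaussians"
    unfolding fourier_two_scale_gaussian[OF s]
    using s by (intro poly_gaussians.scale two_scale_gaussian_poly_gaussian) simp
qed (rule two_scale_gaussian_poly_gaussian[OF s])

text \<open>At the origin \<open>f\<close> contributes \<open>s ^ CARD('n) + 1\<close>, while the
  summand with parameter 1 keeps the transform at least 1 there. For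
  \<open>scaled_gaussian s\<close> alone the powers of \<open>s\<close> would cancel. Continuity
  transfers the value at a point to the essential supremum.\<close>

lemma rihaczek_two_scale_gaussian_ge:
  assumes s: "s \<ge> 1"
  shows "ennreal s \<le> Lp_norm \<infinity> (rihaczek (two_scale_gaussian s :: real ^ 'n \<Rightarrow> complex))"
proof -
  define f where "f = (two_scale_gaussian s :: real ^ 'n \<Rightarrow> complex)"
  have f: "continuous_on UNIV f" "continuous_on UNIV (fourier f)"
    using s unfolding f_def
    by (auto simp: fourier_two_scale_gaussian intro!: continuous_poly_gaussian poly_gaussians.scale two_scale_gaussian_poly_gaussian)
  have "rihaczek f = (\<lambda>z. exp (- (\<i> * complex_of_real (fst z \<bullet> snd z))) * f (fst z) * cnj (fourier f (snd z)))"
    by (auto simp: rihaczek_def fun_eq_iff)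
  then have cont: "continuous_on UNIV (rihaczek f)"
    by (simp only:) (intro continuous_intros continuous_on_compose2[OF f(1)] continuous_on_compose2[OF f(2)] subset_UNIV)
  have val: "two_scale_gaussian a (0::real ^ 'n) = complex_of_real (a ^ CARD('n) + 1)" for a
    by (simp add: two_scale_gaussian_def scaled_gaussian_def gaussian_def)
  have "s * 1 * 1 \<le> (s ^ CARD('n) + 1) * sqrt (2 * pi) ^ CARD('n) * ((1 / s) ^ CARD('n) + 1)"
  proof (intro mult_mono)
    show "s \<le> s ^ CARD('n) + 1"
      using self_le_power[of s "CARD('n)"] s by simp
    have "1 \<le> sqrt (2 * pi)" using pi_gt3 by simp
    then show "1 \<le> sqrt (2 * pi) ^ CARD('n)" by (rule one_le_power)
  qed (use s in auto)
  also have "\<dots> = norm (rihaczek f (0, 0))"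
  proof -
    have "rihaczek f (0, 0) = complex_of_real ((s ^ CARD('n) + 1) * (sqrt (2 * pi) ^ CARD('n) * ((1 / s) ^ CARD('n) + 1)))"
      using s by (simp add: rihaczek_def f_def fourier_two_scale_gaussian val)
    then show ?thesis using s by (simp only: norm_of_real) (simp add: abs_mult)
  qed
  finally have "ennreal s \<le> ennreal (norm (rihaczek f (0, 0)))" by (intro ennreal_leI) simp
  also have "\<dots> \<le> Lp_norm \<infinity> (rihaczek f)" by (rule norm_le_Lp_norm_infinity[OF cont])
  finally show ?thesis unfolding f_def .
qed

section \<open>The contradiction\<close>

theorem mainTheorem5:
  fixes \<omega> :: "real \<Rightarrow> real" and p :: ennreal
  assumes "weight_function \<omega>" and "2 \<le> p"
  shows "\<not> (\<exists>D::real. D > 0 \<and>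
    (\<forall>f :: real ^ 'n \<Rightarrow> complex. f \<in> S_space \<omega> \<longrightarrow>
      Lp_norm \<infinity> (rihaczek f) \<le> ennreal D * Lp_norm p (wigner f)))"
proof
  assume "\<exists>D::real. D > 0 \<and> (\<forall>f :: real ^ 'n \<Rightarrow> complex. f \<in> S_space \<omega> \<longrightarrow>
      Lp_norm \<infinity> (rihaczek f) \<le> ennreal D * Lp_norm p (wigner f))"
  then obtain D where D: "D > 0" "\<And>f :: real ^ 'n \<Rightarrow> complex. f \<in> S_space \<omega> \<Longrightarrow>
      Lp_norm \<infinity> (rihaczek f) \<le> ennreal D * Lp_norm p (wigner f)" by blast
  have nonneg: "0 \<le> 4 * sqrt (4 * pi) ^ CARD('n)" "0 \<le> 16 * (2 * pi\<^sup>2) ^ CARD('n)" by simp_all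
  \<comment> \<open>The two bounds are those for the Wigner transforms of the test functions and do
    not involve \<open>s\<close>; hence neither does \<open>C\<close>.\<close>
  obtain C where C: "C \<ge> 0" and "\<forall>F :: (real ^ 'n) \<times> (real ^ 'n) \<Rightarrow> complex.
    continuous_on UNIV F \<longrightarrow> (\<forall>z. norm (F z) \<le> 4 * sqrt (4 * pi) ^ CARD('n)) \<longrightarrow>
    (\<integral>\<^sup>+z. ennreal ((norm (F z))\<^sup>2) \<partial>lborel) \<le> ennreal (16 * (2 * pi\<^sup>2) ^ CARD('n)) \<longrightarrow> Lp_norm p F \<le> ennreal C"
    using Lp_norm_bound_exists[OF assms(2) nonneg] by blast
  then have wig: "Lp_norm p (wigner (two_scale_gaussian s :: real ^ 'n \<Rightarrow> complex)) \<le> ennreal C" if "s > 0" for s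
    using that continuous_wigner_two_scale_gaussian wigner_two_scale_gaussian_bound nn_integral_wigner_two_scale_gaussian
    by blast
  \<comment> \<open>As \<open>C\<close> is already fixed, \<open>s\<close> may depend on it: the
    lower bound \<open>s\<close> for the Rihaczek norm then exceeds the upper bound
    \<open>D * C\<close>.\<close>
  define s where "s = D * C + 1"
  have s: "s \<ge> 1" using C D(1) by (simp add: s_def)
  have "ennreal s \<le> Lp_norm \<infinity> (rihaczek (two_scale_gaussian s :: real ^ 'n \<Rightarrow> complex))"
    by (rule rihaczek_two_scale_gaussian_ge[OF s])
  also have "\<dots> \<le> ennreal D * Lp_norm p (wigner (two_scale_gaussian s :: real ^ 'n \<Rightarrow> complex))"
    using s by (intro D two_scale_gaussian_in_S_space assms) simp
  also have "\<dots> \<le> ennreal D * ennreal C"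
    using s by (intro mult_left_mono wig) auto
  also have "\<dots> = ennreal (D * C)"
    using C D(1) by (simp add: ennreal_mult)
  finally have "s \<le> D * C" using C D(1) by (simp add: ennreal_le_iff)
  then show False by (simp add: s_def)
qed

end
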